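(* Let $0<2k\le n\le N$, let $A\in\mathbb{R}^{n\times N}$ be such that any $2k$ of its columns are linearly independent, let $x^*\in\mathbb{R}^N$ have support $\Lambda=\mathrm{supp}(x^* )$ with $|\Lambda|=k$, and let $b=Ax^*$. Suppose that the constant stepsize $\alpha>0$ of IHT satisfies $\alpha<\frac{1}{1+U_{2k}}$, and that $$\left\|A_{\Gamma}^{\dagger}A_{\Lambda\setminus\Gamma}x^*_{\Lambda\setminus\Gamma}\right\|<\alpha\left\|A_{\Lambda\setminus\Gamma}^T(I-A_{\Gamma}A^{\dagger}_{\Gamma})A_{\Lambda\setminus\Gamma}x^*_{\Lambda\setminus\Gamma}\right\|$$ for all index sets $\Gamma\neq\Lambda$ with $|\Gamma|=k$. Then the IHT iterates $\{x^m\}$ converge to the only fixed point of IHT with stepsize $\alpha$, namely the original signal $x^*$.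
   Context: $\|\cdot\|$ is the Euclidean norm and $\|y\|_0$ the number of nonzero entries of $y$. $x_\Gamma$, $A_\Gamma$ denote restriction to the entries, respectively columns, indexed by $\Gamma\subseteq\{1,\dots,N\}$; $\Gamma^C=\{1,\dots,N\}\setminus\Gamma$; $A_\Gamma^\dagger=(A_\Gamma^TA_\Gamma)^{-1}A_\Gamma^T$. The upper RIP constant of order $s$ is $U_s=\max_{1\le\|y\|_0\le s}\frac{\|Ay\|^2}{\|y\|^2}-1$. Hard thresholding: $\mathcal{H}_k(x)$ keeps the $k$ entries of $x$ of largest magnitude and sets the others to zero (ties broken by some selection rule). IHT with stepsize $\alpha$: $x^0=0$ and $x^{m+1}=\mathcal{H}_k\{x^m-\alpha A^T(Ax^m-b)\}$ for $m\ge0$. A fixed point of IHT with stepsize $\alpha$ means the same as an $\alpha$-stable point: a vector $\bar x\in\mathbb{R}^N$ for which there is an index set $\Gamma$ with $|\Gamma|=k$ such that $\mathrm{supp}(\bar x)\subseteq\Gamma$, $\{A^T(b-A\bar x)\}_\Gamma=0$, and $\min_{i\in\Gamma}|\bar x_i|\ge\alpha\max_{j\in\Gamma^C}|\{A^T(b-A\bar x)\}_j|$. *)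

theory Defs
  imports "HOL-Analysis.Analysis"
begin

text \<open>
  Restrictions to an index set are zero-padded: vectors stay in \<open>real ^ 'N\<close> and matrices keep
  all their columns, the entries (columns) outside the index set being replaced by zero.
  Products and Euclidean norms of the restricted objects are unaffected by this. The exception
  is inversion: a padded Gram matrix is to be inverted as a \<open>\<Gamma> \<times> \<Gamma>\<close> matrix, see \<open>block_inv\<close>.
\<close>

definition supp :: "real ^ 'N \<Rightarrow> 'N set" where
  "supp x = {i. x $ i \<noteq> 0}"

definition norm0 :: "real ^ 'N \<Rightarrow> nat" where
  "norm0 x = card (supp x)"

definition restr :: "'N set \<Rightarrow> real ^ 'N \<Rightarrow> real ^ 'N" where
  "restr \<Gamma> x = (\<chi> i. if i \<in> \<Gamma> then x $ i else 0)"

definition cols :: "'N set \<Rightarrow> real ^ 'N ^ 'n \<Rightarrow> real ^ 'N ^ 'n" where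
  "cols \<Gamma> A = (\<chi> i j. if j \<in> \<Gamma> then A $ i $ j else 0)"

definition block_id :: "'N set \<Rightarrow> real ^ 'N ^ 'N" where
  "block_id \<Gamma> = (\<chi> i j. if i = j \<and> i \<in> \<Gamma> then 1 else 0)"

text \<open>
  For \<open>G\<close> vanishing outside \<open>\<Gamma> \<times> \<Gamma>\<close>, this is the padded inverse of the \<open>\<Gamma> \<times> \<Gamma>\<close> block of \<open>G\<close>.
  It is unspecified if that block is singular.
\<close>
definition block_inv :: "'N set \<Rightarrow> real ^ 'N ^ 'N \<Rightarrow> real ^ 'N ^ 'N" where
  "block_inv \<Gamma> G = (THE B. (\<forall>i j. i \<notin> \<Gamma> \<or> j \<notin> \<Gamma> \<longrightarrow> B $ i $ j = 0) \<and>
                            G ** B = block_id \<Gamma> \<and> B ** G = block_id \<Gamma>)"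

definition pinv :: "'N set \<Rightarrow> real ^ 'N ^ 'n \<Rightarrow> real ^ 'n ^ 'N" where
  "pinv \<Gamma> A = block_inv \<Gamma> (transpose (cols \<Gamma> A) ** cols \<Gamma> A) ** transpose (cols \<Gamma> A)"

definition lin_indep_cols :: "real ^ 'N ^ 'n \<Rightarrow> 'N set \<Rightarrow> bool" where
  "lin_indep_cols A S \<longleftrightarrow>
     inj_on (\<lambda>j. column j A) S \<and> independent ((\<lambda>j. column j A) ` S)"

text \<open>The supremum is attained for \<open>s \<ge> 1\<close>, see \<open>upper_rip_attained\<close>.\<close>
definition upper_rip :: "real ^ 'N ^ 'n \<Rightarrow> nat \<Rightarrow> real" where
  "upper_rip A s =
     (SUP y\<in>{y. 1 \<le> norm0 y \<and> norm0 y \<le> s}. (norm (A *v y))\<^sup>2 / (norm y)\<^sup>2) - 1"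

lemma upper_rip_attained:
  fixes A :: "real ^ 'N ^ 'n"
  assumes "1 \<le> s"
  obtains z where "1 \<le> norm0 z" "norm0 z \<le> s"
    "upper_rip A s = (norm (A *v z))\<^sup>2 / (norm z)\<^sup>2 - 1"
    "\<And>y. 1 \<le> norm0 y \<Longrightarrow> norm0 y \<le> s \<Longrightarrow>
       (norm (A *v y))\<^sup>2 / (norm y)\<^sup>2 \<le> (norm (A *v z))\<^sup>2 / (norm z)\<^sup>2"
proof -
  let ?q = "\<lambda>y. (norm (A *v y))\<^sup>2 / (norm y)\<^sup>2"
  let ?Y = "{y::real^'N. 1 \<le> norm0 y \<and> norm0 y \<le> s}"
  define C where "C S = sphere 0 1 \<inter> {y::real^'N. \<forall>i. i \<notin> S \<longrightarrow> y $ i = 0}" for S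
  define K where "K = (\<Union>S\<in>{S. card S \<le> s}. C S)"
  have "closed {y::real^'N. \<forall>i. i \<notin> S \<longrightarrow> y $ i = 0}" for S
    by (intro closed_Collect_all closed_Collect_imp closed_Collect_eq continuous_intros) simp_all
  then have "compact (C S)" for S
    unfolding C_def by (intro compact_Int_closed) simp_all
  then have comp: "compact K"
    unfolding K_def by (intro compact_UN) simp_all
  have pos: "1 \<le> norm0 y \<longleftrightarrow> y \<noteq> 0" for y :: "real^'N"
    by (auto simp: norm0_def supp_def vec_eq_iff Suc_le_eq card_gt_0_iff)
  have mem: "y \<in> K \<longleftrightarrow> norm y = 1 \<and> norm0 y \<le> s" for y
  proof
    assume "y \<in> K"
    then obtain S where S: "card S \<le> s" "norm y = 1" "\<forall>i. i \<notin> S \<longrightarrow> y $ i = 0"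
      by (auto simp: K_def C_def)
    then have "supp y \<subseteq> S" by (auto simp: supp_def)
    then have "norm0 y \<le> card S" by (simp add: norm0_def card_mono)
    with S show "norm y = 1 \<and> norm0 y \<le> s" by simp
  next
    assume "norm y = 1 \<and> norm0 y \<le> s"
    then show "y \<in> K"
      by (auto simp: K_def C_def norm0_def supp_def intro!: exI[of _ "supp y"])
  qed
  have nrm: "y /\<^sub>R norm y \<in> K \<and> ?q (y /\<^sub>R norm y) = ?q y" if "y \<in> ?Y" for y
  proof -
    have "y \<noteq> 0" using that pos by auto
    moreover from this have "norm0 (y /\<^sub>R norm y) = norm0 y" by (simp add: norm0_def supp_def)
    ultimately show ?thesis using that
      by (auto simp: mem matrix_vector_mult_scaleR power_divide divide_simps power_mult_distrib)
  qed
  have "norm0 (axis undefined 1 :: real^'N) = 1"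
    by (simp add: norm0_def supp_def axis_def)
  then have "axis undefined 1 \<in> K" using assms by (simp add: mem)
  then have ne: "K \<noteq> {}" by blast
  have cont: "continuous_on K ?q"
    by (intro continuous_intros linear_continuous_on) (auto simp: mem)
  from continuous_attains_sup[OF comp ne cont] obtain z
    where z: "z \<in> K" "\<And>y. y \<in> K \<Longrightarrow> ?q y \<le> ?q z" by blast
  have zY: "z \<in> ?Y" using z(1) pos[of z] by (auto simp: mem)
  have max: "?q y \<le> ?q z" if "y \<in> ?Y" for y
    using nrm[OF that] z(2) by metis
  have "(SUP y\<in>?Y. ?q y) = ?q z"
    using zY max by (intro cSup_eq_maximum) auto
  then show ?thesis
    using that[of z] zY max unfolding upper_rip_def by auto
qed

text \<open>
  A selection rule chooses \<open>k\<close> positions of entries of largest magnitude; the freedom in this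
  choice is exactly the breaking of ties.
\<close>
definition selection_rule :: "nat \<Rightarrow> (real ^ 'N \<Rightarrow> 'N set) \<Rightarrow> bool" where
  "selection_rule k sel \<longleftrightarrow>
     (\<forall>x. card (sel x) = k \<and> (\<forall>i\<in>sel x. \<forall>j\<in>- sel x. \<bar>x $ j\<bar> \<le> \<bar>x $ i\<bar>))"

definition hard_threshold :: "(real ^ 'N \<Rightarrow> 'N set) \<Rightarrow> real ^ 'N \<Rightarrow> real ^ 'N" where
  "hard_threshold sel x = restr (sel x) x"

primrec iht ::
  "(real ^ 'N \<Rightarrow> 'N set) \<Rightarrow> real ^ 'N ^ 'n \<Rightarrow> real ^ 'n \<Rightarrow> real \<Rightarrow> nat \<Rightarrow> real ^ 'N" where
  "iht sel A b \<alpha> 0 = 0"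
| "iht sel A b \<alpha> (Suc m) =
     hard_threshold sel (iht sel A b \<alpha> m - \<alpha> *\<^sub>R (transpose A *v (A *v iht sel A b \<alpha> m - b)))"

definition stable_point ::
  "nat \<Rightarrow> real ^ 'N ^ 'n \<Rightarrow> real ^ 'n \<Rightarrow> real \<Rightarrow> real ^ 'N \<Rightarrow> bool" where
  "stable_point k A b \<alpha> x \<longleftrightarrow>
     (\<exists>\<Gamma>. card \<Gamma> = k \<and> supp x \<subseteq> \<Gamma> \<and>
          restr \<Gamma> (transpose A *v (b - A *v x)) = 0 \<and>
          Min ((\<lambda>i. \<bar>x $ i\<bar>) ` \<Gamma>)
            \<ge> \<alpha> * Max ((\<lambda>j. \<bar>(transpose A *v (b - A *v x)) $ j\<bar>) ` (- \<Gamma>)))"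

end

theory Submission
  imports Defs
begin

text \<open>
  Hard thresholding is best \<open>k\<close>-term approximation, so the step size condition makes
  \<open>\<parallel>A x\<^sup>m - b\<parallel>\<^sup>2\<close> decrease by at least a positive multiple of
  \<open>\<parallel>x\<^sup>m\<^sup>+\<^sup>1 - x\<^sup>m\<parallel>\<^sup>2\<close>. Hence consecutive differences tend to zero, the
  iterates stay bounded, and every limit point is stable. If a stable point with index set
  \<open>\<Gamma> \<noteq> \<Lambda>\<close> existed, its entries on \<open>\<Gamma> - \<Lambda>\<close> would be entries of
  \<open>A\<^sub>\<Gamma>\<^sup>\<dagger> A\<^bsub>\<Lambda>-\<Gamma>\<^esub> xs\<^bsub>\<Lambda>-\<Gamma>\<^esub>\<close>; as \<open>\<Gamma> - \<Lambda>\<close> and \<open>\<Lambda> - \<Gamma>\<close> have the same size, comparing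
  them with the residual correlations on \<open>\<Lambda> - \<Gamma>\<close> contradicts the hypothesis. A bounded
  sequence with a single limit point converges.
\<close>

section \<open>Inner products, transposes and zero-padded restrictions\<close>

declare transpose_matrix_vector [simp del]

lemma norm_sq_eq_sum: "(norm (x :: real ^ 'N))\<^sup>2 = (\<Sum>i\<in>UNIV. (x $ i)\<^sup>2)"
  unfolding power2_norm_eq_inner by (simp add: inner_vec_def power2_eq_square)

lemma inner_transpose_mult:
  fixes A :: "real ^ 'N ^ 'n"
  shows "x \<bullet> (transpose A *v r) = (A *v x) \<bullet> r"
  by (metis dot_lmul_matrix inner_commute transpose_matrix_vector)

lemma restr_nth [simp]: "restr \<Gamma> x $ i = (if i \<in> \<Gamma> then x $ i else 0)"
  by (simp add: restr_def)

lemma restr_id: "supp x \<subseteq> \<Gamma> \<Longrightarrow> restr \<Gamma> x = x"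
  by (auto simp: vec_eq_iff supp_def)

lemma supp_restr: "supp (restr \<Gamma> x) \<subseteq> \<Gamma>"
  by (auto simp: supp_def)

lemma supp_diff: "supp (x - y) \<subseteq> supp x \<union> supp y"
  by (auto simp: supp_def)

lemma restr_0 [simp]: "restr \<Gamma> 0 = 0"
  by (simp add: vec_eq_iff)

lemma restr_restr [simp]: "restr \<Gamma> (restr \<Gamma> x) = restr \<Gamma> x"
  by (simp add: vec_eq_iff)

lemma restr_diff: "restr \<Gamma> (x - y) = restr \<Gamma> x - restr \<Gamma> y"
  by (simp add: vec_eq_iff)

lemma restr_eq_0_iff: "restr \<Gamma> x = 0 \<longleftrightarrow> supp x \<subseteq> - \<Gamma>"
  by (auto simp: vec_eq_iff supp_def)

lemma cols_mult: "cols \<Gamma> A *v x = A *v restr \<Gamma> x"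
  by (auto simp: vec_eq_iff cols_def matrix_vector_mult_def intro!: sum.cong)

lemma transpose_cols_mult: "transpose (cols \<Gamma> A) *v r = restr \<Gamma> (transpose A *v r)"
  by (auto simp: vec_eq_iff cols_def matrix_vector_mult_def transpose_def)

lemma block_id_mult: "block_id \<Gamma> *v x = restr \<Gamma> x"
proof -
  have "(\<Sum>j\<in>UNIV. (if i = j \<and> i \<in> \<Gamma> then 1 else 0) * x $ j) = (if i \<in> \<Gamma> then x $ i else 0)" for i
  proof -
    have "(\<Sum>j\<in>UNIV. (if i = j \<and> i \<in> \<Gamma> then 1 else 0) * x $ j)
        = (\<Sum>j\<in>UNIV. if i = j then (if i \<in> \<Gamma> then x $ j else 0) else 0)"
      by (intro sum.cong) auto
    then show ?thesis by simp
  qed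
  then show ?thesis
    by (simp add: vec_eq_iff block_id_def matrix_vector_mult_def)
qed

section \<open>Independent columns, block inverses and the pseudoinverse\<close>

lemma lin_indep_cols_inj:
  fixes A :: "real ^ 'N ^ 'n"
  assumes ind: "lin_indep_cols A S" and sub: "supp y \<subseteq> S" and eq: "A *v y = 0"
  shows "y = 0"
proof -
  let ?c = "\<lambda>j. column j A"
  have inj: "inj_on ?c S" and indep: "independent (?c ` S)"
    using ind by (auto simp: lin_indep_cols_def)
  \<comment> \<open>Independence concerns the set of column vectors, so the entries of
    \<open>y\<close> become coefficients on vectors; injectivity of \<open>?c\<close> on
    \<open>S\<close> makes this well defined.\<close>
  define u where "u v = y $ the_inv_into S ?c v" for v
  have uc: "u (?c j) = y $ j" if "j \<in> S" for j
    using the_inv_into_f_f[OF inj that] by (simp add: u_def)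
  have "(\<Sum>v\<in>?c ` S. u v *\<^sub>R v) = (\<Sum>j\<in>S. y $ j *\<^sub>R ?c j)"
    by (simp add: sum.reindex[OF inj] uc)
  also have "\<dots> = (\<Sum>j\<in>UNIV. y $ j *s ?c j)"
    using sub by (intro sum.mono_neutral_cong_left)
      (auto simp: supp_def scalar_mult_eq_scaleR)
  also have "\<dots> = 0"
    using eq by (simp add: matrix_mult_sum)
  finally have "u v = 0" if "v \<in> ?c ` S" for v
    using real_vector.independentD[OF indep _ subset_refl _ that] by simp
  then have "y $ j = 0" for j
    using uc sub by (cases "j \<in> S") (auto simp: supp_def)
  then show ?thesis by (simp add: vec_eq_iff)
qed

lemma lin_indep_cols_mono: "lin_indep_cols A S \<Longrightarrow> T \<subseteq> S \<Longrightarrow> lin_indep_cols A T"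
  unfolding lin_indep_cols_def
  by (meson image_mono inj_on_subset real_vector.independent_mono)

text \<open>Pairing the restricted vector with \<open>y\<close> yields the squared norm of
  \<open>A *v y\<close>. This is invertibility of the Gram block, in kernel form.\<close>

lemma normal_eq_inj:
  fixes A :: "real ^ 'N ^ 'n"
  assumes "lin_indep_cols A \<Gamma>" and "supp y \<subseteq> \<Gamma>"
    and "restr \<Gamma> (transpose A *v (A *v y)) = 0"
  shows "y = 0"
proof -
  let ?r = "transpose A *v (A *v y)"
  have "(A *v y) \<bullet> (A *v y) = y \<bullet> ?r"
    by (simp add: inner_transpose_mult)
  also have "\<dots> = y \<bullet> restr \<Gamma> ?r"
    using assms(2) by (auto simp: inner_vec_def supp_def intro!: sum.cong)
  finally have "A *v y = 0" using assms(3) by simp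
  with assms show ?thesis using lin_indep_cols_inj by blast
qed

text \<open>Inverses are unique in the monoid of matrices vanishing outside \<Gamma> \<times>
  \<Gamma>, whose unit is \<open>block_id \<Gamma>\<close>. This discharges the definite description
  in \<open>block_inv\<close>.\<close>

lemma block_inv_unique:
  fixes B :: "real ^ 'N ^ 'N"
  assumes pad: "\<And>i j. i \<notin> \<Gamma> \<or> j \<notin> \<Gamma> \<Longrightarrow> B $ i $ j = 0"
    and GB: "G ** B = block_id \<Gamma>" and BG: "B ** G = block_id \<Gamma>"
  shows "block_inv \<Gamma> G = B"
  unfolding block_inv_def
proof (rule the_equality, intro conjI allI impI)
  fix C :: "real ^ 'N ^ 'N"
  assume C: "(\<forall>i j. i \<notin> \<Gamma> \<or> j \<notin> \<Gamma> \<longrightarrow> C $ i $ j = 0) \<and> G ** C = block_id \<Gamma> \<and> C ** G = block_id \<Gamma>"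
  then have padC: "\<And>i j. i \<notin> \<Gamma> \<or> j \<notin> \<Gamma> \<Longrightarrow> C $ i $ j = 0" by blast
  have "C = C ** block_id \<Gamma>"
  proof (subst matrix_eq, intro allI)
    fix x
    show "C *v x = (C ** block_id \<Gamma>) *v x"
      unfolding matrix_vector_mul_assoc[symmetric] block_id_mult
      using padC by (auto simp: vec_eq_iff matrix_vector_mult_def intro!: sum.cong)
  qed
  also have "\<dots> = block_id \<Gamma> ** B"
    using C by (simp add: GB[symmetric] matrix_mul_assoc)
  also have "\<dots> = B"
  proof (subst matrix_eq, intro allI)
    fix x
    show "(block_id \<Gamma> ** B) *v x = B *v x"
      unfolding matrix_vector_mul_assoc[symmetric] block_id_mult
      using pad by (auto simp: vec_eq_iff matrix_vector_mult_def)
  qed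
  finally show "C = B" .
qed (use assms in auto)

lemma block_inv_Gram:
  fixes A :: "real ^ 'N ^ 'n"
  assumes ind: "lin_indep_cols A \<Gamma>"
  defines "G \<equiv> transpose (cols \<Gamma> A) ** cols \<Gamma> A"
  shows "G ** block_inv \<Gamma> G = block_id \<Gamma>"
    and "block_id \<Gamma> ** block_inv \<Gamma> G = block_inv \<Gamma> G"
proof -
  let ?E = "block_id \<Gamma> :: real ^ 'N ^ 'N"
  text \<open>Completing the singular padded Gram matrix by the identity on the complement of
    \<open>\<Gamma>\<close> gives an invertible matrix that commutes with the projection \<open>block_id \<Gamma>\<close>.\<close>
  define M where "M = G + block_id (- \<Gamma>)"
  have Gv: "G *v x = restr \<Gamma> (transpose A *v (A *v restr \<Gamma> x))" for x
    by (simp add: G_def matrix_vector_mul_assoc[symmetric] cols_mult transpose_cols_mult)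
  have Mv: "M *v x = G *v x + restr (- \<Gamma>) x" for x
    by (simp add: M_def matrix_vector_mult_add_rdistrib block_id_mult)
  have "x = 0" if "M *v x = 0" for x
  proof -
    \<comment> \<open>The two summands of \<open>M *v x\<close> live on \<Gamma> and on its
      complement, so they vanish separately.\<close>
    have "restr \<Gamma> (M *v x) = G *v x" "restr (- \<Gamma>) (M *v x) = restr (- \<Gamma>) x"
      by (auto simp: vec_eq_iff Mv Gv)
    with that have g: "G *v x = 0" and c: "restr (- \<Gamma>) x = 0"
      by simp_all
    then have s: "supp x \<subseteq> \<Gamma>" by (simp add: restr_eq_0_iff)
    then show ?thesis
      using g normal_eq_inj[OF ind s] by (simp add: Gv restr_id)
  qed
  then obtain N where NM: "N ** M = mat 1"
    using matrix_left_invertible_ker by blast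
  then have MN: "M ** N = mat 1"
    using matrix_left_right_inverse by blast
  have ME: "M ** ?E = G" and EM: "?E ** M = G" and EE: "?E ** ?E = ?E"
    by (auto simp: matrix_eq matrix_vector_mul_assoc[symmetric] block_id_mult Mv Gv vec_eq_iff)
  \<comment> \<open>\<open>?E ** M\<close> and \<open>M ** ?E\<close> are both \<open>G\<close>, so
    \<open>?E\<close> commutes with \<open>M\<close> and hence with its inverse
    \<open>N\<close>.\<close>
  have "N ** ?E = N ** ?E ** (M ** N)" by (simp add: MN)
  also have "\<dots> = N ** (?E ** M) ** N" by (simp add: matrix_mul_assoc)
  also have "\<dots> = N ** M ** ?E ** N" by (simp add: EM ME[symmetric] matrix_mul_assoc)
  finally have NE: "N ** ?E = ?E ** N" by (simp add: NM)
  let ?B = "?E ** N"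
  have GB: "G ** ?B = ?E"
  proof -
    have "G ** ?B = ?E ** M ** (N ** ?E)" by (simp add: EM NE)
    also have "\<dots> = ?E ** (M ** N) ** ?E" by (simp add: matrix_mul_assoc)
    finally show ?thesis by (simp add: MN EE)
  qed
  have BG: "?B ** G = ?E"
  proof -
    have "?B ** G = ?E ** (N ** M) ** ?E" by (simp add: ME[symmetric] matrix_mul_assoc)
    then show ?thesis by (simp add: NM EE)
  qed
  \<comment> \<open>\<open>?E ** N\<close> has zero rows outside \<Gamma>; rewritten as
    \<open>N ** ?E\<close> it also has zero columns there.\<close>
  have "?B $ i $ j = 0" if "i \<notin> \<Gamma> \<or> j \<notin> \<Gamma>" for i j
  proof (cases "i \<in> \<Gamma>")
    case False
    then show ?thesis
      by (simp add: matrix_matrix_mult_def block_id_def)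
  next
    case True
    with that have "(N ** ?E) $ i $ j = 0"
      by (auto simp: matrix_matrix_mult_def block_id_def intro!: sum.neutral)
    then show ?thesis by (simp add: NE)
  qed
  then have "block_inv \<Gamma> G = ?B"
    using GB BG by (intro block_inv_unique) auto
  then show "G ** block_inv \<Gamma> G = ?E" and "?E ** block_inv \<Gamma> G = block_inv \<Gamma> G"
    using GB EE by (simp_all add: matrix_mul_assoc)
qed

text \<open>The vector \<open>pinv \<Gamma> A *v v\<close> solves the normal equations, whose
  solution on \<Gamma> is unique. A pseudoinverse image can thus be identified by checking a
  residual.\<close>

lemma pinv_unique:
  fixes A :: "real ^ 'N ^ 'n"
  assumes ind: "lin_indep_cols A \<Gamma>" and sub: "supp y \<subseteq> \<Gamma>"
    and normal: "restr \<Gamma> (transpose A *v (v - A *v y)) = 0"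
  shows "pinv \<Gamma> A *v v = y"
proof -
  let ?G = "transpose (cols \<Gamma> A) ** cols \<Gamma> A" and ?w = "pinv \<Gamma> A *v v"
  have G: "?G *v x = restr \<Gamma> (transpose A *v (A *v restr \<Gamma> x))" for x
    by (simp add: matrix_vector_mul_assoc[symmetric] cols_mult transpose_cols_mult)
  have "restr \<Gamma> ?w = ?w"
    using block_inv_Gram(2)[OF ind]
    by (metis (no_types) block_id_mult matrix_vector_mul_assoc pinv_def)
  then have w: "supp ?w \<subseteq> \<Gamma>" by (metis supp_restr)
  have "?G *v ?w = (?G ** block_inv \<Gamma> ?G) *v (transpose (cols \<Gamma> A) *v v)"
    by (simp add: pinv_def matrix_vector_mul_assoc matrix_mul_assoc)
  also have "\<dots> = restr \<Gamma> (transpose A *v v)"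
    unfolding block_inv_Gram(1)[OF ind] block_id_mult transpose_cols_mult
    by (simp add: restr_id supp_restr)
  finally have "restr \<Gamma> (transpose A *v (A *v ?w)) = restr \<Gamma> (transpose A *v v)"
    using w by (simp add: G restr_id)
  then have "restr \<Gamma> (transpose A *v (A *v (?w - y))) = 0"
    using normal by (simp add: matrix_vector_mult_diff_distrib restr_diff)
  moreover have "supp (?w - y) \<subseteq> \<Gamma>"
    using w sub supp_diff by blast
  ultimately show ?thesis
    using normal_eq_inj[OF ind] by fastforce
qed

section \<open>Hard thresholding, descent of the residual and boundedness\<close>

text \<open>Moving the kept positions from \<open>sel g\<close> to the support of \<open>z\<close>
  can only lose energy of \<open>g\<close>: each position gained is dominated by every position
  given up, and no more are gained than given up.\<close>

lemma hard_threshold_best_approx: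
  assumes sel: "selection_rule k sel" and z: "norm0 z \<le> k"
  shows "(norm (hard_threshold sel g - g))\<^sup>2 \<le> (norm (z - g))\<^sup>2"
proof -
  define S where "S = sel g"
  define T where "T = supp z"
  have card: "card S = k" "card T \<le> k"
    and dom: "\<And>i j. i \<in> S \<Longrightarrow> j \<notin> S \<Longrightarrow> \<bar>g $ j\<bar> \<le> \<bar>g $ i\<bar>"
    using sel z by (auto simp: selection_rule_def S_def T_def norm0_def)
  have "card (T - S) \<le> card (S - T)"
    using card by (simp add: card_Diff_subset_Int Int_commute)
  then obtain h where h: "h ` (T - S) \<subseteq> S - T" "inj_on h (T - S)"
    using card_le_inj[of "T - S" "S - T"] by auto
  have "(\<Sum>i\<in>T - S. (g $ i)\<^sup>2) \<le> (\<Sum>i\<in>T - S. (g $ h i)\<^sup>2)"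
    using h(1) dom by (intro sum_mono) (auto simp: abs_le_square_iff[symmetric])
  also have "\<dots> = (\<Sum>i\<in>h ` (T - S). (g $ i)\<^sup>2)"
    using h(2) by (simp add: sum.reindex)
  also have "\<dots> \<le> (\<Sum>i\<in>S - T. (g $ i)\<^sup>2)"
    using h(1) by (intro sum_mono2) auto
  finally have le: "(\<Sum>i\<in>T - S. (g $ i)\<^sup>2) \<le> (\<Sum>i\<in>S - T. (g $ i)\<^sup>2)" .
  have "(norm (hard_threshold sel g - g))\<^sup>2 = (\<Sum>i\<in>- S. (g $ i)\<^sup>2)"
    unfolding norm_sq_eq_sum by (rule sum.mono_neutral_cong_right) (auto simp: hard_threshold_def S_def)
  also have "\<dots> = (\<Sum>i\<in>T - S. (g $ i)\<^sup>2) + (\<Sum>i\<in>- (S \<union> T). (g $ i)\<^sup>2)"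
    by (subst sum.union_disjoint[symmetric]) (auto intro!: sum.cong)
  also have "\<dots> \<le> (\<Sum>i\<in>S - T. (g $ i)\<^sup>2) + (\<Sum>i\<in>- (S \<union> T). (g $ i)\<^sup>2)"
    using le by simp
  also have "\<dots> = (\<Sum>i\<in>- T. (g $ i)\<^sup>2)"
    by (subst sum.union_disjoint[symmetric]) (auto intro!: sum.cong)
  also have "\<dots> = (\<Sum>i\<in>- T. ((z - g) $ i)\<^sup>2)"
    by (intro sum.cong) (auto simp: T_def supp_def)
  also have "\<dots> \<le> (norm (z - g))\<^sup>2"
    unfolding norm_sq_eq_sum by (rule sum_mono2) auto
  finally show ?thesis .
qed

lemma norm0_diff_le: "norm0 (x - y) \<le> norm0 x + norm0 y"
  unfolding norm0_def
  by (rule order_trans[OF card_mono[OF _ supp_diff] card_Un_le]) simp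

lemma upper_rip_bound:
  fixes A :: "real ^ 'N ^ 'n"
  assumes "1 \<le> s" and "norm0 y \<le> s"
  shows "(norm (A *v y))\<^sup>2 \<le> (1 + upper_rip A s) * (norm y)\<^sup>2"
proof (cases "y = 0")
  case False
  then have "1 \<le> norm0 y"
    by (auto simp: norm0_def supp_def vec_eq_iff Suc_le_eq card_gt_0_iff)
  moreover obtain z where "upper_rip A s = (norm (A *v z))\<^sup>2 / (norm z)\<^sup>2 - 1"
    "\<And>y. 1 \<le> norm0 y \<Longrightarrow> norm0 y \<le> s \<Longrightarrow>
       (norm (A *v y))\<^sup>2 / (norm y)\<^sup>2 \<le> (norm (A *v z))\<^sup>2 / (norm z)\<^sup>2"
    using upper_rip_attained[OF assms(1), of A] by metis
  ultimately have "(norm (A *v y))\<^sup>2 / (norm y)\<^sup>2 \<le> 1 + upper_rip A s"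
    using assms(2) by simp
  with False show ?thesis by (simp add: divide_le_eq)
qed simp

lemma norm0_hard_threshold: "selection_rule k sel \<Longrightarrow> norm0 (hard_threshold sel x) \<le> k"
  unfolding norm0_def hard_threshold_def selection_rule_def
  by (metis card_mono finite_class.finite supp_restr)

lemma norm0_iht:
  assumes "selection_rule k sel"
  shows "norm0 (iht sel A b \<alpha> m) \<le> k"
  by (cases m) (simp_all add: norm0_hard_threshold[OF assms], simp add: norm0_def supp_def)

text \<open>The sparse vector \<open>x\<close> itself competes in the best approximation of its
  gradient step, which bounds the cross term of the new residual. The quadratic term is bounded by
  the RIP constant, of order \<open>2 * k\<close> because the step is a difference of two
  \<open>k\<close>-sparse vectors.\<close>

lemma iht_descent:
  fixes A :: "real ^ 'N ^ 'n" and x :: "real ^ 'N" and b :: "real ^ 'n"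
  assumes k: "0 < k" and sel: "selection_rule k sel" and \<alpha>: "\<alpha> > 0" and x: "norm0 x \<le> k"
  defines "y \<equiv> hard_threshold sel (x - \<alpha> *\<^sub>R (transpose A *v (A *v x - b)))"
  shows "(norm (A *v y - b))\<^sup>2 \<le>
    (norm (A *v x - b))\<^sup>2 - (1 / \<alpha> - (1 + upper_rip A (2 * k))) * (norm (y - x))\<^sup>2"
proof -
  define d where "d = y - x"
  define r where "r = A *v x - b"
  have "norm0 y \<le> k"
    unfolding y_def by (rule norm0_hard_threshold[OF sel])
  then have "norm0 d \<le> 2 * k"
    using norm0_diff_le[of y x] x by (simp add: d_def)
  then have rip: "(norm (A *v d))\<^sup>2 \<le> (1 + upper_rip A (2 * k)) * (norm d)\<^sup>2"
    using k by (intro upper_rip_bound) auto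
  have "(norm (y - (x - \<alpha> *\<^sub>R (transpose A *v r))))\<^sup>2 \<le> (norm (x - (x - \<alpha> *\<^sub>R (transpose A *v r))))\<^sup>2"
    unfolding y_def r_def by (rule hard_threshold_best_approx[OF sel x])
  also have "y - (x - \<alpha> *\<^sub>R (transpose A *v r)) = d + \<alpha> *\<^sub>R (transpose A *v r)"
    by (simp add: d_def)
  also have "x - (x - \<alpha> *\<^sub>R (transpose A *v r)) = \<alpha> *\<^sub>R (transpose A *v r)"
    by simp
  \<comment> \<open>The squared norm of \<open>\<alpha> *\<^sub>R (transpose A *v r)\<close> cancels
    on both sides.\<close>
  finally have "(norm d)\<^sup>2 + 2 * \<alpha> * ((A *v d) \<bullet> r) \<le> 0"
    unfolding power2_norm_eq_inner inner_transpose_mult[symmetric]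
    by (simp add: inner_add inner_commute)
  then have cross: "2 * ((A *v d) \<bullet> r) \<le> - (1 / \<alpha>) * (norm d)\<^sup>2"
    using \<alpha> by (simp add: field_simps)
  have "A *v y - b = A *v d + r"
    by (simp add: d_def r_def matrix_vector_mult_diff_distrib)
  then have "(norm (A *v y - b))\<^sup>2 = (norm (A *v d))\<^sup>2 + 2 * ((A *v d) \<bullet> r) + (norm r)\<^sup>2"
    by (simp add: power2_norm_eq_inner inner_add inner_commute)
  also have "\<dots> \<le> (norm r)\<^sup>2 - (1 / \<alpha> - (1 + upper_rip A (2 * k))) * (norm d)\<^sup>2"
    using rip cross by (simp add: algebra_simps)
  finally show ?thesis by (simp add: d_def r_def)
qed

lemma
  fixes A :: "real ^ 'N ^ 'n"
  assumes "0 < k" and "selection_rule k sel" and "\<alpha> > 0"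
    and "\<alpha> < 1 / (1 + upper_rip A (2 * k))"
  shows iht_residual_le: "norm (A *v iht sel A b \<alpha> m - b) \<le> norm b"
    and iht_asymptotically_regular: "(\<lambda>m. iht sel A b \<alpha> (Suc m) - iht sel A b \<alpha> m) \<longlonglongrightarrow> 0"
proof -
  define x where "x = iht sel A b \<alpha>"
  define f where "f m = (norm (A *v x m - b))\<^sup>2" for m
  define c where "c = 1 / \<alpha> - (1 + upper_rip A (2 * k))"
  \<comment> \<open>Since division by zero gives 0, a nonpositive denominator would make the
    quotient nonpositive, against 0 < \<alpha>.\<close>
  have U: "0 < 1 + upper_rip A (2 * k)"
    using assms(3,4) by (smt (verit) divide_nonneg_nonpos)
  then have c: "c > 0"
    using assms(3,4) by (simp add: c_def field_simps)
  have step: "f (Suc m) \<le> f m - c * (norm (x (Suc m) - x m))\<^sup>2" for m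
    using iht_descent[OF assms(1-3) norm0_iht[OF assms(2)], of A A b \<alpha> m b]
    by (simp add: f_def x_def c_def)
  have dec: "decseq f"
  proof (rule decseq_SucI)
    fix m
    have "0 \<le> c * (norm (x (Suc m) - x m))\<^sup>2" using c by simp
    with step[of m] show "f (Suc m) \<le> f m" by linarith
  qed
  \<comment> \<open>The iteration starts at zero, so \<open>f 0\<close> is the squared norm of
    \<open>b\<close>.\<close>
  have "f m \<le> f 0" using dec by (simp add: decseqD)
  then show "norm (A *v iht sel A b \<alpha> m - b) \<le> norm b"
    by (simp add: f_def x_def)
  have "\<And>m. 0 \<le> f m" by (simp add: f_def)
  then obtain l where l: "f \<longlonglongrightarrow> l"
    using decseq_convergent[OF dec] by metis
  \<comment> \<open>The decreasing nonnegative \<open>f\<close> converges, so its differences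
    vanish; by \<open>step\<close> they dominate the squared steps.\<close>
  have "(\<lambda>m. (f m - f (Suc m)) / c) \<longlonglongrightarrow> (l - l) / c"
    using c by (intro tendsto_intros l filterlim_compose[OF l filterlim_Suc]) auto
  then have lim: "(\<lambda>m. (f m - f (Suc m)) / c) \<longlonglongrightarrow> 0" by simp
  have "(norm (x (Suc m) - x m))\<^sup>2 \<le> (f m - f (Suc m)) / c" for m
    using step[of m] c by (simp add: field_simps)
  then have "(\<lambda>m. (norm (x (Suc m) - x m))\<^sup>2) \<longlonglongrightarrow> 0"
    by (intro tendsto_sandwich[OF _ _ tendsto_const lim]) auto
  then have "(\<lambda>m. sqrt ((norm (x (Suc m) - x m))\<^sup>2)) \<longlonglongrightarrow> sqrt 0"
    by (rule tendsto_real_sqrt)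
  then show "(\<lambda>m. iht sel A b \<alpha> (Suc m) - iht sel A b \<alpha> m) \<longlonglongrightarrow> 0"
    by (simp add: x_def tendsto_norm_zero_iff)
qed

text \<open>On each coordinate subspace of dimension \<open>k\<close>, \<open>A\<close> is injective
  and hence bounded below; finitely many of these subspaces cover the sparse vectors. The bound on
  \<open>k\<close> lets a smaller support grow to size exactly \<open>k\<close>.\<close>

lemma bounded_sparse_preimage:
  fixes A :: "real ^ 'N ^ 'n"
  assumes ind: "\<And>S. card S = k \<Longrightarrow> lin_indep_cols A S" and k: "k \<le> CARD('N)"
  shows "bounded {y. norm0 y \<le> k \<and> norm (A *v y) \<le> C}"
proof -
  have "bounded {y. supp y \<subseteq> S \<and> norm (A *v y) \<le> C}" if S: "card S = k" for S
  proof -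
    let ?V = "{y :: real ^ 'N. supp y \<subseteq> S}"
    have sub: "subspace ?V"
      by (rule subspaceI) (auto simp: supp_def, metis (mono_tags) add_0 mem_Collect_eq subset_iff)
    obtain e where e: "e > 0" "\<And>y. y \<in> ?V \<Longrightarrow> e * norm y \<le> norm (A *v y)"
      using injective_imp_isometric[OF closed_subspace[OF sub] sub, of "(*v) A"]
        lin_indep_cols_inj[OF ind[OF S]] by (auto simp: matrix_vector_mul_bounded_linear)
    have "norm y \<le> C / e" if "supp y \<subseteq> S" "norm (A *v y) \<le> C" for y
      using e(2)[of y] that e(1) by (simp add: field_simps)
    then show ?thesis by (auto simp: bounded_iff)
  qed
  then have "bounded (\<Union>S\<in>{S. card S = k}. {y. supp y \<subseteq> S \<and> norm (A *v y) \<le> C})"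
    by (intro bounded_UN) auto
  moreover have "{y. norm0 y \<le> k \<and> norm (A *v y) \<le> C}
      \<subseteq> (\<Union>S\<in>{S. card S = k}. {y. supp y \<subseteq> S \<and> norm (A *v y) \<le> C})"
  proof (clarsimp, goal_cases)
    case (1 y)
    then show ?case
      using exists_subset_between[of "supp y" k UNIV] k by (auto simp: norm0_def)
  qed
  ultimately show ?thesis by (rule bounded_subset)
qed

section \<open>Stable points and their uniqueness\<close>

text \<open>For \<open>0 < k < CARD('N)\<close>, neither \<open>\<Gamma>\<close> nor its complement is empty,
  so \<open>Min\<close> and \<open>Max\<close> in \<open>stable_point\<close> are genuine.\<close>
lemma stable_point_iff:
  fixes A :: "real ^ 'N ^ 'n"
  assumes "0 < k" and "k < CARD('N)" and "\<alpha> > 0"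
  shows "stable_point k A b \<alpha> x \<longleftrightarrow>
    (\<exists>\<Gamma>. card \<Gamma> = k \<and> supp x \<subseteq> \<Gamma> \<and> restr \<Gamma> (transpose A *v (b - A *v x)) = 0 \<and>
      (\<forall>i\<in>\<Gamma>. \<forall>j\<in>- \<Gamma>. \<alpha> * \<bar>(transpose A *v (b - A *v x)) $ j\<bar> \<le> \<bar>x $ i\<bar>))"
proof -
  have "Min ((\<lambda>i. \<bar>x $ i\<bar>) ` \<Gamma>) \<ge> \<alpha> * Max ((\<lambda>j. \<bar>v $ j\<bar>) ` (- \<Gamma>)) \<longleftrightarrow>
      (\<forall>i\<in>\<Gamma>. \<forall>j\<in>- \<Gamma>. \<alpha> * \<bar>v $ j\<bar> \<le> \<bar>x $ i\<bar>)" if "card \<Gamma> = k" for \<Gamma> and v :: "real ^ 'N"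
  proof -
    have ne: "\<Gamma> \<noteq> {}" "- \<Gamma> \<noteq> {}" using that assms
      by (metis card.empty less_irrefl, metis boolean_algebra.compl_zero double_compl less_irrefl)
    have "\<alpha> * Max ((\<lambda>j. \<bar>v $ j\<bar>) ` (- \<Gamma>)) \<le> t \<longleftrightarrow> (\<forall>j\<in>- \<Gamma>. \<alpha> * \<bar>v $ j\<bar> \<le> t)" for t
    proof -
      have "\<alpha> * Max ((\<lambda>j. \<bar>v $ j\<bar>) ` (- \<Gamma>)) \<le> t \<longleftrightarrow> Max ((\<lambda>j. \<bar>v $ j\<bar>) ` (- \<Gamma>)) \<le> t / \<alpha>"
        using assms by (simp add: field_simps)
      also have "\<dots> \<longleftrightarrow> (\<forall>j\<in>- \<Gamma>. \<bar>v $ j\<bar> \<le> t / \<alpha>)"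
        using ne by simp
      finally show ?thesis using assms by (simp add: field_simps)
    qed
    then show ?thesis using ne by (auto simp: Min_ge_iff)
  qed
  then show ?thesis unfolding stable_point_def by blast
qed

lemma stable_point_unique:
  fixes A :: "real ^ 'N ^ 'n"
  assumes k: "0 < k" "k < CARD('N)" and \<alpha>: "\<alpha> > 0"
    and ind: "\<And>S. card S = k \<Longrightarrow> lin_indep_cols A S"
    and card: "card (supp xs) = k"
    and small: "\<And>\<Gamma>. card \<Gamma> = k \<Longrightarrow> \<Gamma> \<noteq> supp xs \<Longrightarrow>
      norm (pinv \<Gamma> A *v (cols (supp xs - \<Gamma>) A *v restr (supp xs - \<Gamma>) xs))
        < \<alpha> * norm (transpose (cols (supp xs - \<Gamma>) A) *v
            ((mat 1 - cols \<Gamma> A ** pinv \<Gamma> A) *v (cols (supp xs - \<Gamma>) A *v restr (supp xs - \<Gamma>) xs)))"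
    and stable: "stable_point k A (A *v xs) \<alpha> x"
  shows "x = xs"
proof -
  let ?\<Lambda> = "supp xs" and ?r = "A *v xs - A *v x"
  obtain \<Gamma> where \<Gamma>: "card \<Gamma> = k" "supp x \<subseteq> \<Gamma>" "restr \<Gamma> (transpose A *v ?r) = 0"
    and dom: "\<And>i j. i \<in> \<Gamma> \<Longrightarrow> j \<notin> \<Gamma> \<Longrightarrow> \<alpha> * \<bar>(transpose A *v ?r) $ j\<bar> \<le> \<bar>x $ i\<bar>"
    using stable unfolding stable_point_iff[OF k \<alpha>] by auto
  note ind\<Gamma> = ind[OF \<Gamma>(1)]
  show ?thesis
  proof (cases "\<Gamma> = ?\<Lambda>")
    case True
    \<comment> \<open>Here \<open>xs - x\<close> lives on \<Gamma> and solves the homogeneous normal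
      equations.\<close>
    then have "supp (xs - x) \<subseteq> \<Gamma>" using \<Gamma>(2) supp_diff by blast
    with normal_eq_inj[OF ind\<Gamma>, of "xs - x"] \<Gamma>(3) show ?thesis
      by (simp add: matrix_vector_mult_diff_distrib)
  next
    case False
    define D where "D = ?\<Lambda> - \<Gamma>"
    \<comment> \<open>On \<Gamma>, \<open>x\<close> is the least squares solution for
      \<open>A *v xs\<close>. Removing the part of \<open>xs\<close> on \<Gamma> leaves the one for
      \<open>A *v restr D xs\<close>, so \<open>w\<close> is the vector on the left of
      \<open>small\<close>.\<close>
    define w where "w = x - restr \<Gamma> xs"
    have xs: "xs = restr \<Gamma> xs + restr D xs"
      by (auto simp: vec_eq_iff D_def supp_def)
    have r: "?r = A *v restr D xs - A *v w"
      by (subst xs) (simp add: w_def algebra_simps)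
    have supp_w: "supp w \<subseteq> \<Gamma>"
      using \<Gamma>(2) by (auto simp: w_def supp_def)
    have v: "cols D A *v restr D xs = A *v restr D xs"
      by (simp add: cols_mult restr_id supp_restr)
    have pw: "pinv \<Gamma> A *v (A *v restr D xs) = w"
      by (rule pinv_unique[OF ind\<Gamma> supp_w]) (use \<Gamma>(3) r in simp)
    \<comment> \<open>The projection residual of \<open>A *v restr D xs\<close> is the residual of
      \<open>x\<close> itself, so the right side of \<open>small\<close> involves exactly
      correlations that stability bounds.\<close>
    have "(mat 1 - cols \<Gamma> A ** pinv \<Gamma> A) *v (A *v restr D xs) = ?r"
      by (simp add: r matrix_vector_mult_diff_rdistrib matrix_vector_mul_assoc[symmetric] pw
          cols_mult restr_id[OF supp_w])
    then have lt: "norm w < \<alpha> * norm (restr D (transpose A *v ?r))"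
      using small[OF \<Gamma>(1) False] by (simp add: D_def[symmetric] v pw transpose_cols_mult)
    have cards: "card D = card (\<Gamma> - ?\<Lambda>)"
      using card \<Gamma>(1) by (simp add: D_def card_Diff_subset_Int Int_commute)
    then obtain h where h: "bij_betw h D (\<Gamma> - ?\<Lambda>)"
      using finite_same_card_bij[of D "\<Gamma> - ?\<Lambda>"] by auto
    have "(\<alpha> * norm (restr D (transpose A *v ?r)))\<^sup>2 = (norm (\<alpha> *\<^sub>R restr D (transpose A *v ?r)))\<^sup>2"
      using \<alpha> by simp
    also have "\<dots> = (\<Sum>j\<in>D. (\<alpha> * \<bar>(transpose A *v ?r) $ j\<bar>)\<^sup>2)"
      unfolding norm_sq_eq_sum by (rule sum.mono_neutral_cong_right) (auto simp: power_mult_distrib)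
    also have "\<dots> \<le> (\<Sum>j\<in>D. (w $ h j)\<^sup>2)"
    proof (intro sum_mono)
      fix j assume j: "j \<in> D"
      then have hj: "h j \<in> \<Gamma> - ?\<Lambda>" using h by (auto simp: bij_betw_def)
      \<comment> \<open>Off the support of \<open>xs\<close>, \<open>w\<close> agrees with
        \<open>x\<close>, so stability applies to the pair \<open>h j\<close>,
        \<open>j\<close>.\<close>
      then have "w $ h j = x $ h j" by (auto simp: w_def supp_def)
      moreover have "(\<alpha> * \<bar>(transpose A *v ?r) $ j\<bar>)\<^sup>2 \<le> \<bar>x $ h j\<bar>\<^sup>2"
        using dom[of "h j" j] hj j \<alpha> by (intro power_mono) (auto simp: D_def)
      ultimately show "(\<alpha> * \<bar>(transpose A *v ?r) $ j\<bar>)\<^sup>2 \<le> (w $ h j)\<^sup>2" by simp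
    qed
    also have "\<dots> = (\<Sum>i\<in>\<Gamma> - ?\<Lambda>. (w $ i)\<^sup>2)"
      by (rule sum.reindex_bij_betw[OF h])
    also have "\<dots> \<le> (norm w)\<^sup>2"
      unfolding norm_sq_eq_sum by (rule sum_mono2) auto
    finally have "\<alpha> * norm (restr D (transpose A *v ?r)) \<le> norm w"
      by (rule power2_le_imp_le) simp
    with lt show ?thesis by simp
  qed
qed

section \<open>Limit points and convergence of the iterates\<close>

text \<open>Hard thresholding is discontinuous, so the limit is taken along a subsequence whose
  selected set is constant; there only the continuous gradient step matters.\<close>

lemma iht_limit_point_stable:
  fixes A :: "real ^ 'N ^ 'n"
  assumes k: "0 < k" "k < CARD('N)" and \<alpha>: "\<alpha> > 0" and sel: "selection_rule k sel"
    and s: "filterlim s at_top sequentially"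
    and lim: "(\<lambda>m. iht sel A b \<alpha> (s m)) \<longlonglongrightarrow> x"
    and diff: "(\<lambda>m. iht sel A b \<alpha> (Suc m) - iht sel A b \<alpha> m) \<longlonglongrightarrow> 0"
  shows "stable_point k A b \<alpha> x"
proof -
  define g where "g y = y - \<alpha> *\<^sub>R (transpose A *v (A *v y - b))" for y
  let ?x = "iht sel A b \<alpha>"
  \<comment> \<open>There are finitely many index sets, so one is selected infinitely often.\<close>
  obtain \<Gamma> where inf: "infinite {m. sel (g (?x (s m))) = \<Gamma>}"
    using pigeonhole_infinite[of "UNIV :: nat set" "\<lambda>m. sel (g (?x (s m)))"] by auto
  obtain t :: "nat \<Rightarrow> nat" where t: "strict_mono t" "\<And>m. sel (g (?x (s (t m)))) = \<Gamma>"
    using infinite_enumerate[OF inf] by auto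
  define u where "u m = s (t m)" for m
  have u: "filterlim u at_top sequentially"
    unfolding u_def by (rule filterlim_compose[OF s filterlim_subseq[OF t(1)]])
  have lim_u: "(\<lambda>m. ?x (u m)) \<longlonglongrightarrow> x"
    unfolding u_def by (rule filterlim_compose[OF lim filterlim_subseq[OF t(1)]])
  \<comment> \<open>Vanishing steps give the successor iterates the same limit, so the recursion
    passes to an equation for \<open>x\<close>.\<close>
  have "(\<lambda>m. (?x (Suc (u m)) - ?x (u m)) + ?x (u m)) \<longlonglongrightarrow> 0 + x"
    by (intro tendsto_add lim_u filterlim_compose[OF diff u])
  then have lim_Suc: "(\<lambda>m. ?x (Suc (u m))) \<longlonglongrightarrow> x" by (simp del: iht.simps)
  have "(\<lambda>m. g (?x (u m))) \<longlonglongrightarrow> g x"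
    unfolding g_def
    by (intro tendsto_intros lim_u bounded_linear.tendsto[OF matrix_vector_mul_bounded_linear])
  then have lim_g: "(\<lambda>m. g (?x (u m)) $ i) \<longlonglongrightarrow> g x $ i" for i
    by (rule tendsto_vec_nth)
  have x: "x $ i = (if i \<in> \<Gamma> then g x $ i else 0)" for i
  proof -
    have "?x (Suc (u m)) $ i = (if i \<in> \<Gamma> then g (?x (u m)) $ i else 0)" for m
      using t(2)[of m] by (simp add: hard_threshold_def u_def g_def)
    then have "(\<lambda>m. ?x (Suc (u m)) $ i) \<longlonglongrightarrow> (if i \<in> \<Gamma> then g x $ i else 0)"
      using lim_g[of i] by auto
    then show ?thesis
      using tendsto_vec_nth[OF lim_Suc] LIMSEQ_unique by blast
  qed
  have gr: "g x = x + \<alpha> *\<^sub>R (transpose A *v (b - A *v x))"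
    by (simp add: g_def algebra_simps)
  have rs: "card \<Gamma> = k" "\<And>m i j. i \<in> \<Gamma> \<Longrightarrow> j \<notin> \<Gamma> \<Longrightarrow> \<bar>g (?x (u m)) $ j\<bar> \<le> \<bar>g (?x (u m)) $ i\<bar>"
    using sel t(2) unfolding selection_rule_def u_def by (metis, metis ComplI)
  have "\<alpha> * \<bar>(transpose A *v (b - A *v x)) $ j\<bar> \<le> \<bar>x $ i\<bar>" if ij: "i \<in> \<Gamma>" "j \<notin> \<Gamma>" for i j
  proof -
    have "\<bar>g x $ j\<bar> \<le> \<bar>g x $ i\<bar>"
      using ij rs(2) by (intro LIMSEQ_le[OF tendsto_rabs[OF lim_g] tendsto_rabs[OF lim_g]]) auto
    \<comment> \<open>Off \<Gamma> the limit is zero, and \<open>g x\<close> reduces to the scaled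
      residual correlation.\<close>
    moreover have "g x $ i = x $ i" "g x $ j = \<alpha> * (transpose A *v (b - A *v x)) $ j"
      using x[of i] x[of j] ij by (simp_all add: gr)
    ultimately show ?thesis using \<alpha> by (simp add: abs_mult)
  qed
  moreover have "supp x \<subseteq> \<Gamma>"
    using x by (auto simp: supp_def split: if_splits)
  moreover have "restr \<Gamma> (transpose A *v (b - A *v x)) = 0"
  proof (subst vec_eq_iff, intro allI)
    fix i
    have "x $ i = g x $ i" if "i \<in> \<Gamma>" using x[of i] that by simp
    then show "restr \<Gamma> (transpose A *v (b - A *v x)) $ i = 0 $ i"
      unfolding gr using \<alpha> by auto
  qed
  ultimately show ?thesis
    unfolding stable_point_iff[OF k \<alpha>] using rs(1) by auto
qed

text \<open>If convergence failed, infinitely many terms would stay at distance at least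
  \<open>e\<close> from \<open>l\<close>; being bounded, they would have a limit point other than
  \<open>l\<close>.\<close>

lemma tendsto_if_unique_limit_point:
  fixes f :: "nat \<Rightarrow> 'a :: heine_borel"
  assumes bdd: "bounded (range f)"
    and uniq: "\<And>s l'. filterlim s at_top sequentially \<Longrightarrow> (\<lambda>m. f (s m)) \<longlonglongrightarrow> l' \<Longrightarrow> l' = l"
  shows "f \<longlonglongrightarrow> l"
proof (rule ccontr)
  assume "\<not> f \<longlonglongrightarrow> l"
  then obtain e where e: "e > 0" and "\<not> eventually (\<lambda>m. dist (f m) l < e) sequentially"
    by (auto simp: tendsto_iff)
  then have "infinite {m. \<not> dist (f m) l < e}"
    by (simp add: cofinite_eq_sequentially[symmetric] eventually_cofinite)
  then obtain s :: "nat \<Rightarrow> nat" where s: "strict_mono s" "\<And>m. \<not> dist (f (s m)) l < e"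
    using infinite_enumerate by blast
  have "bounded (range (f \<circ> s))"
    using bdd by (rule bounded_subset) auto
  then obtain l' t where t: "strict_mono t" and l': "(f \<circ> s \<circ> t) \<longlonglongrightarrow> l'"
    using bounded_imp_convergent_subsequence by blast
  have "l' = l"
    using l' by (intro uniq[of "s \<circ> t"] filterlim_subseq strict_mono_o s t) (simp add: o_def)
  with l' e have "eventually (\<lambda>m. dist ((f \<circ> s \<circ> t) m) l < e) sequentially"
    by (auto simp: tendsto_iff)
  then show False
    using s(2) by (auto simp: eventually_sequentially)
qed

theorem theorem3p8:
  fixes A :: "real ^ 'N ^ 'n"
    and xs :: "real ^ 'N"
    and b :: "real ^ 'n"
    and \<alpha> :: real
    and k :: nat
    and \<Lambda> :: "'N set"
    and sel :: "real ^ 'N \<Rightarrow> 'N set"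
  assumes "0 < 2 * k" and "2 * k \<le> CARD('n)" and "CARD('n) \<le> CARD('N)"
    and "\<And>S. card S = 2 * k \<Longrightarrow> lin_indep_cols A S"
    and "\<Lambda> = supp xs" and "card \<Lambda> = k"
    and "b = A *v xs"
    and "selection_rule k sel"
    and "\<alpha> > 0" and "\<alpha> < 1 / (1 + upper_rip A (2 * k))"
    and "\<And>\<Gamma>. card \<Gamma> = k \<Longrightarrow> \<Gamma> \<noteq> \<Lambda> \<Longrightarrow>
      norm (pinv \<Gamma> A *v (cols (\<Lambda> - \<Gamma>) A *v restr (\<Lambda> - \<Gamma>) xs))
        < \<alpha> * norm (transpose (cols (\<Lambda> - \<Gamma>) A) *v
            ((mat 1 - cols \<Gamma> A ** pinv \<Gamma> A) *v (cols (\<Lambda> - \<Gamma>) A *v restr (\<Lambda> - \<Gamma>) xs)))"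
  shows "iht sel A b \<alpha> \<longlonglongrightarrow> xs \<and> (\<forall>x. stable_point k A b \<alpha> x \<longleftrightarrow> x = xs)"
proof -
  have k: "0 < k" "k < CARD('N)" using assms(1-3) by auto
  have ind: "lin_indep_cols A S" if S: "card S = k" for S
  proof -
    obtain T where "S \<subseteq> T" "card T = 2 * k"
      using exists_subset_between[of S "2 * k" UNIV] assms(2,3) S by auto
    then show ?thesis using assms(4) lin_indep_cols_mono by blast
  qed
  have uniq: "x = xs" if "stable_point k A b \<alpha> x" for x
    by (rule stable_point_unique[OF k assms(9) ind])
      (use assms(5-7,11) that in auto)
  \<comment> \<open>The residual at \<open>xs\<close> is zero, so \<Lambda> is a witness.\<close>
  have stable: "stable_point k A b \<alpha> xs"
    unfolding stable_point_iff[OF k assms(9)] using assms(5-7)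
    by (intro exI[of _ \<Lambda>]) simp
  \<comment> \<open>The residual bound controls the images; injectivity of \<open>A\<close> on
    sparse supports then bounds the iterates.\<close>
  have "norm (A *v iht sel A b \<alpha> m) \<le> 2 * norm b" for m
    using iht_residual_le[OF k(1) assms(8-10), of b m]
      norm_triangle_ineq[of "A *v iht sel A b \<alpha> m - b" b] by simp
  then have "range (iht sel A b \<alpha>) \<subseteq> {y. norm0 y \<le> k \<and> norm (A *v y) \<le> 2 * norm b}"
    using norm0_iht[OF assms(8)] by auto
  then have "bounded (range (iht sel A b \<alpha>))"
    by (rule bounded_subset[rotated]) (rule bounded_sparse_preimage[OF ind], use k(2) in auto)
  then have "iht sel A b \<alpha> \<longlonglongrightarrow> xs"
  proof (rule tendsto_if_unique_limit_point)
    fix s l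
    assume "filterlim s at_top sequentially" "(\<lambda>m. iht sel A b \<alpha> (s m)) \<longlonglongrightarrow> l"
    then show "l = xs"
      by (rule uniq[OF iht_limit_point_stable[OF k assms(9,8) _ _
              iht_asymptotically_regular[OF k(1) assms(8-10)]]])
  qed
  with uniq stable show ?thesis by blast
qed

end
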